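(* Let $n\ge1$, let $\Lambda_1,\dots,\Lambda_{n-1},T,w$ be positive integers and $\lambda_c$ an integer with $0\le\lambda_c<w$, and put $N=\Lambda_1\Lambda_2\cdots\Lambda_{n-1}T$. Suppose that a $(\Lambda_1\times\cdots\times\Lambda_{n-1}\times T,w,0,\lambda_c)$ OOC exists, and let $\Phi$ denote the largest size $|C|$ of a $(\Lambda_1\times\cdots\times\Lambda_{n-1}\times T,w,0,\lambda_c)$ OOC $C$. Then $$\Phi\le\left\lfloor\frac{N}{Tw}\left\lfloor\frac{N-T}{w-1}\left\lfloor\frac{N-2T}{w-2}\left\lfloor\cdots\left\lfloor\frac{N-\lambda_cT}{w-\lambda_c}\right\rfloor\cdots\right\rfloor\right\rfloor\right\rfloor\right\rfloor .$$ In particular, if $w=\frac NT$ (the maximal possible weight), then $\Phi\le T^{\lambda_c}$.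
   Context: An $n$-dimensional optical orthogonal code ($n$-D OOC) with parameters $(\Lambda_1\times\cdots\times\Lambda_{n-1}\times T,w,\lambda_a,\lambda_c)$ is a nonempty set $C$ of binary ($0/1$) arrays $A=(a_{i_1,\dots,i_n})$, indexed by $0\le i_s\le\Lambda_s-1$ for $1\le s\le n-1$ and $0\le i_n\le T-1$, called codewords, each having exactly $w$ entries equal to $1$, such that (the last subscript being read modulo $T$): (i) for every $A\in C$ and every integer $1\le t\le T-1$, $\sum_{i_1,\dots,i_n}a_{i_1,\dots,i_n}a_{i_1,\dots,i_n+t}\le\lambda_a$; (ii) for all distinct $A,B\in C$ and every integer $0\le t\le T-1$, $\sum_{i_1,\dots,i_n}a_{i_1,\dots,i_n}b_{i_1,\dots,i_n+t}\le\lambda_c$. The sums run over all index tuples. A code with $\lambda_a=0$ is called ideal. In the nested floor expression the factors inside the outer factor $\frac{N}{Tw}$ are $\frac{N-iT}{w-i}$ for $i=1,\dots,\lambda_c$; for $\lambda_c=0$ it is $\lfloor N/(Tw)\rfloor$. *)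

theory Defs
  imports Complex_Main "HOL-Library.FuncSet"
begin

text \<open>An index tuple $(i_1,\dots,i_n)$ is represented as the pair of
  $(i_1,\dots,i_{n-1})$, an extensional function on \<^term>\<open>{1..<n}\<close>, and $i_n$.\<close>

definition ooc_index :: "nat \<Rightarrow> (nat \<Rightarrow> nat) \<Rightarrow> nat \<Rightarrow> ((nat \<Rightarrow> nat) \<times> nat) set" where
  "ooc_index n \<Lambda> T = (\<Pi>\<^sub>E s\<in>{1..<n}. {..<\<Lambda> s}) \<times> {..<T}"

text \<open>Arrays are extensional (\<^const>\<open>undefined\<close> outside the index set), so that distinct
  functions are distinct arrays and \<^const>\<open>card\<close> of a code is its number of codewords.\<close>

definition binary_arrays :: "nat \<Rightarrow> (nat \<Rightarrow> nat) \<Rightarrow> nat \<Rightarrow> ((nat \<Rightarrow> nat) \<times> nat \<Rightarrow> nat) set" where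
  "binary_arrays n \<Lambda> T = (ooc_index n \<Lambda> T \<rightarrow>\<^sub>E {0, 1})"

definition correlation ::
  "nat \<Rightarrow> (nat \<Rightarrow> nat) \<Rightarrow> nat \<Rightarrow> ((nat \<Rightarrow> nat) \<times> nat \<Rightarrow> nat) \<Rightarrow> ((nat \<Rightarrow> nat) \<times> nat \<Rightarrow> nat) \<Rightarrow> nat \<Rightarrow> nat"
  where
  "correlation n \<Lambda> T A B t = (\<Sum>(i, j)\<in>ooc_index n \<Lambda> T. A (i, j) * B (i, (j + t) mod T))"

definition is_ooc ::
  "nat \<Rightarrow> (nat \<Rightarrow> nat) \<Rightarrow> nat \<Rightarrow> nat \<Rightarrow> nat \<Rightarrow> nat \<Rightarrow> ((nat \<Rightarrow> nat) \<times> nat \<Rightarrow> nat) set \<Rightarrow> bool" where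
  "is_ooc n \<Lambda> T w la lc C \<longleftrightarrow>
     C \<noteq> {} \<and> C \<subseteq> binary_arrays n \<Lambda> T \<and>
     (\<forall>A\<in>C. card {p \<in> ooc_index n \<Lambda> T. A p = 1} = w) \<and>
     (\<forall>A\<in>C. \<forall>t. 1 \<le> t \<and> t < T \<longrightarrow> correlation n \<Lambda> T A A t \<le> la) \<and>
     (\<forall>A\<in>C. \<forall>B\<in>C. A \<noteq> B \<longrightarrow> (\<forall>t<T. correlation n \<Lambda> T A B t \<le> lc))"

definition max_ooc_size :: "nat \<Rightarrow> (nat \<Rightarrow> nat) \<Rightarrow> nat \<Rightarrow> nat \<Rightarrow> nat \<Rightarrow> nat \<Rightarrow> nat" where
  "max_ooc_size n \<Lambda> T w la lc = Max {card C |C. is_ooc n \<Lambda> T w la lc C}"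

text \<open>The \<^const>\<open>Max\<close> above is a genuine maximum whenever a code exists.\<close>

lemma finite_binary_arrays: "finite (binary_arrays n \<Lambda> T)"
  unfolding binary_arrays_def ooc_index_def
  by (intro finite_PiE finite_cartesian_product) simp_all

lemma finite_ooc_sizes: "finite {card C |C. is_ooc n \<Lambda> T w la lc C}"
proof -
  have "{card C |C. is_ooc n \<Lambda> T w la lc C} \<subseteq> card ` Pow (binary_arrays n \<Lambda> T)"
    unfolding is_ooc_def by blast
  moreover have "finite (card ` Pow (binary_arrays n \<Lambda> T))"
    by (intro finite_imageI finite_Pow_iff[THEN iffD2] finite_binary_arrays)
  ultimately show ?thesis
    by (rule finite_subset)
qed

text \<open>\<^term>\<open>nested_floor k f\<close> is
  $\lfloor f_0 \lfloor f_1 \lfloor \cdots \lfloor f_k \rfloor \cdots \rfloor\rfloor\rfloor$.\<close>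

primrec nested_floor :: "nat \<Rightarrow> (nat \<Rightarrow> real) \<Rightarrow> int" where
  "nested_floor 0 f = \<lfloor>f 0\<rfloor>"
| "nested_floor (Suc k) f = \<lfloor>f 0 * of_int (nested_floor k (\<lambda>i. f (Suc i)))\<rfloor>"

definition johnson_factor :: "nat \<Rightarrow> nat \<Rightarrow> nat \<Rightarrow> nat \<Rightarrow> real" where
  "johnson_factor N T w i =
     (if i = 0 then real N / (real T * real w)
      else (real N - real i * real T) / (real w - real i))"

end

theory Submission
  imports Defs "HOL-Number_Theory.Cong"
begin

text \<open>
  Since \<open>\<lambda>\<^sub>a = 0\<close>, a codeword has at most one entry 1 in each of the \<open>M = N / T\<close> rows
  (a row fixes \<open>i\<^sub>1, \<dots>, i\<^bsub>n-1\<^esub>\<close>): two such entries would coincide under some nonzero cyclic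
  shift. So a codeword is a partial function from the rows to the \<open>T\<close> columns, defined on
  \<open>w\<close> rows, and in particular \<open>w \<le> M\<close>. The weight \<open>M\<close> is attained by the code whose only
  codeword has its ones in column 0.

  Partial functions any two of which agree in few rows satisfy a Johnson-type bound
  (\<open>card_packing_le\<close>): through a point \<open>(r, c)\<close> there pass only few members, because
  deleting the point leaves partial functions on one row less, with smaller weight and smaller
  agreement, to which induction applies; counting incidences between points and members then
  bounds the whole family, and rounding down at each level is harmless because cardinalities
  are integers.

  The code itself obeys a stronger bound at the outermost level, with \<open>M / w\<close> in place of
  \<open>M T / w\<close>, because its codewords may be shifted independently of each other: the
  correlation condition covers all shifts. For a row \<open>r\<close>, shift every codeword that meets
  \<open>r\<close> so that it meets \<open>r\<close> in column 0. The results all contain the point \<open>(r, 0)\<close> and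
  still pairwise share at most \<open>\<lambda>\<^sub>c\<close> points. Hence their number is bounded by the inner
  floor expression (\<open>card_meeting_row_le\<close>), and it remains to count incidences between
  rows and codewords.
\<close>

section \<open>Families of partial functions with small pairwise agreement\<close>

text \<open>Taking the innermost value to be 1 lets the induction in \<open>card_packing_le\<close> start at
  families with at most one member.\<close>

primrec iterated_floor :: "nat \<Rightarrow> (nat \<Rightarrow> real) \<Rightarrow> int" where
  "iterated_floor 0 f = 1"
| "iterated_floor (Suc k) f = \<lfloor>f 0 * of_int (iterated_floor k (\<lambda>i. f (Suc i)))\<rfloor>"

lemma nested_floor_eq_iterated_floor: "nested_floor k f = iterated_floor (Suc k) f"
  by (induction k arbitrary: f) auto

lemma iterated_floor_cong:
  "(\<And>i. i < k \<Longrightarrow> f i = g i) \<Longrightarrow> iterated_floor k f = iterated_floor k g"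
proof (induction k arbitrary: f g)
  case (Suc k)
  have "iterated_floor k (\<lambda>i. f (Suc i)) = iterated_floor k (\<lambda>i. g (Suc i))"
    using Suc.prems by (intro Suc.IH) simp
  then show ?case
    using Suc.prems[of 0] by simp
qed simp

lemma iterated_floor_const: "iterated_floor k (\<lambda>_. real c) = int (c ^ k)"
proof (induction k)
  case (Suc k)
  have "\<lfloor>real c * of_int (int (c ^ k))\<rfloor> = \<lfloor>of_int (int (c ^ Suc k)) :: real\<rfloor>"
    by simp
  then show ?case
    using Suc.IH by (simp only: iterated_floor.simps floor_of_int)
qed simp

lemma card_le_of_incidence_bound:
  fixes d :: int
  assumes "finite X" "finite P"
    and weight: "\<And>x. x \<in> X \<Longrightarrow> card {p \<in> P. I x p} = w"
    and degree: "\<And>p. p \<in> P \<Longrightarrow> int (card {x \<in> X. I x p}) \<le> d"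
    and "w > 0"
  shows "int (card X) \<le> \<lfloor>real (card P) / real w * of_int d\<rfloor>"
proof -
  have "w * card X = (\<Sum>x\<in>X. card {p \<in> P. I x p})"
    using weight by simp
  also have "\<dots> = (\<Sum>p\<in>P. card {x \<in> X. I x p})"
    by (rule sum_multicount_gen) (use assms in auto)
  finally have "int (w * card X) = (\<Sum>p\<in>P. int (card {x \<in> X. I x p}))"
    by simp
  also have "\<dots> \<le> int (card P) * d"
    using sum_bounded_above[of P "\<lambda>p. int (card {x \<in> X. I x p})" d] degree by simp
  finally have "real_of_int (int (w * card X)) \<le> real_of_int (int (card P) * d)"
    by (simp only: of_int_le_iff)
  with \<open>w > 0\<close> show ?thesis
    by (simp add: le_floor_iff field_simps)
qed

text \<open>The members are graphs of partial functions from \<open>R\<close> to \<open>V\<close>, whence the injectivity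
  of \<^const>\<open>fst\<close>.\<close>

definition packing :: "'a set \<Rightarrow> 'b set \<Rightarrow> nat \<Rightarrow> nat \<Rightarrow> ('a \<times> 'b) set set \<Rightarrow> bool" where
  "packing R V w k F \<longleftrightarrow>
     (\<forall>X\<in>F. X \<subseteq> R \<times> V \<and> inj_on fst X \<and> card X = w) \<and>
     (\<forall>X\<in>F. \<forall>Y\<in>F. X \<noteq> Y \<longrightarrow> card (X \<inter> Y) < k)"

lemma packing_subset: "packing R V w k F \<Longrightarrow> G \<subseteq> F \<Longrightarrow> packing R V w k G"
  unfolding packing_def by blast

text \<open>Deleting a common point frees its whole row, because no member has a second point
  there. This is why both \<open>R\<close> and the weight shrink by exactly one.\<close>

lemma packing_delete_common_point:
  assumes F: "packing R V w (Suc k) F" and p: "\<And>X. X \<in> F \<Longrightarrow> p \<in> X"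
    and "finite R" "finite V"
  shows "packing (R - {fst p}) V (w - 1) k ((\<lambda>X. X - {p}) ` F)"
    and "card ((\<lambda>X. X - {p}) ` F) = card F"
proof -
  have fin: "finite X" if "X \<in> F" for X
  proof (rule finite_subset)
    show "X \<subseteq> R \<times> V"
      using F that by (simp add: packing_def)
    show "finite (R \<times> V)"
      using assms(3,4) by (rule finite_cartesian_product)
  qed
  have "X - {p} \<subseteq> (R - {fst p}) \<times> V" if "X \<in> F" for X
  proof
    fix q assume q: "q \<in> X - {p}"
    have "inj_on fst X" "X \<subseteq> R \<times> V"
      using F that by (auto simp: packing_def)
    then have "fst q \<noteq> fst p"
      using q p[OF that] by (auto dest: inj_onD)
    then show "q \<in> (R - {fst p}) \<times> V"
      using q \<open>X \<subseteq> R \<times> V\<close> by (auto simp: mem_Times_iff)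
  qed
  moreover have "inj_on fst (X - {p})" if "X \<in> F" for X
    using F that unfolding packing_def by (meson Diff_subset inj_on_subset)
  moreover have "card (X - {p}) = w - 1" if "X \<in> F" for X
    using F p[OF that] that unfolding packing_def by simp
  moreover have "card ((X - {p}) \<inter> (Y - {p})) < k" if "X \<in> F" "Y \<in> F" "X \<noteq> Y" for X Y
  proof -
    have "card (insert p ((X - {p}) \<inter> (Y - {p}))) = Suc (card ((X - {p}) \<inter> (Y - {p})))"
      using fin that(1) by (intro card_insert_disjoint) auto
    moreover have "insert p ((X - {p}) \<inter> (Y - {p})) = X \<inter> Y"
      using p that by blast
    moreover have "card (X \<inter> Y) < Suc k"
      using F that unfolding packing_def by blast
    ultimately show ?thesis
      by simp
  qed
  ultimately show "packing (R - {fst p}) V (w - 1) k ((\<lambda>X. X - {p}) ` F)"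
    unfolding packing_def by (intro conjI ballI impI; elim imageE; metis)
  have "inj_on (\<lambda>X. X - {p}) F"
    using p by (metis (no_types, lifting) inj_onI insert_Diff)
  then show "card ((\<lambda>X. X - {p}) ` F) = card F"
    by (rule card_image)
qed

text \<open>The hypothesis \<open>w \<le> card R\<close> keeps all factors nonnegative, so that the bound is also
  true of an empty family, as may arise at a point that no member contains.\<close>

lemma card_packing_le:
  assumes "packing R V w k F" "finite R" "finite V" "k \<le> w" "w \<le> card R"
  shows "int (card F)
    \<le> iterated_floor k (\<lambda>i. (real (card R) - real i) * real (card V) / (real w - real i))"
  using assms
proof (induction k arbitrary: R w F)
  case 0
  then have "\<forall>X\<in>F. \<forall>Y\<in>F. X = Y"
    unfolding packing_def by blast
  then have "card F \<le> 1"
    by (metis card_le_Suc0_iff_eq card.infinite One_nat_def zero_le)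
  then show ?case
    by simp
next
  case (Suc k)
  define d where "d = iterated_floor k
    (\<lambda>i. (real (card R) - real (Suc i)) * real (card V) / (real w - real (Suc i)))"
  have F: "X \<subseteq> R \<times> V" "card X = w" if "X \<in> F" for X
    using Suc.prems(1) that by (auto simp: packing_def)
  have "F \<subseteq> Pow (R \<times> V)"
    using F(1) by blast
  then have "finite F"
    using Suc.prems(2,3) by (simp add: finite_subset)
  have "int (card {X \<in> F. p \<in> X}) \<le> d" if "p \<in> R \<times> V" for p
  proof -
    let ?G = "{X \<in> F. p \<in> X}"
    have G: "packing R V w (Suc k) ?G"
      using Suc.prems(1) by (rule packing_subset) auto
    have card_R': "card (R - {fst p}) = card R - 1"
      using that by (simp add: mem_Times_iff)
    note del = packing_delete_common_point[OF G _ Suc.prems(2,3), of p]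
    have "int (card ?G) = int (card ((\<lambda>X. X - {p}) ` ?G))"
      using del(2) by simp
    also have "\<dots> \<le> iterated_floor k (\<lambda>i. (real (card (R - {fst p})) - real i)
        * real (card V) / (real (w - 1) - real i))"
      using del(1) Suc.prems by (intro Suc.IH) (auto simp: card_R')
    also have "\<dots> = d"
      unfolding d_def card_R' using Suc.prems(4,5)
      by (intro iterated_floor_cong) (simp add: algebra_simps)
    finally show ?thesis .
  qed
  moreover have "card {p \<in> R \<times> V. p \<in> X} = w" if "X \<in> F" for X
  proof -
    have "{p \<in> R \<times> V. p \<in> X} = X"
      using F(1)[OF that] by blast
    then show ?thesis
      using F(2)[OF that] by simp
  qed
  ultimately have "int (card F) \<le> \<lfloor>real (card (R \<times> V)) / real w * of_int d\<rfloor>"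
    using Suc.prems(2-4) \<open>finite F\<close>
    by (intro card_le_of_incidence_bound[where I = "\<lambda>X p. p \<in> X"]) simp_all
  then show ?case
    by (simp add: d_def card_cartesian_product)
qed

section \<open>Codewords as partial functions\<close>

definition rows :: "nat \<Rightarrow> (nat \<Rightarrow> nat) \<Rightarrow> (nat \<Rightarrow> nat) set" where
  "rows n \<Lambda> = (\<Pi>\<^sub>E s\<in>{1..<n}. {..<\<Lambda> s})"

lemma ooc_index_eq: "ooc_index n \<Lambda> T = rows n \<Lambda> \<times> {..<T}"
  by (simp add: ooc_index_def rows_def)

lemma finite_rows: "finite (rows n \<Lambda>)"
  unfolding rows_def by (intro finite_PiE) auto

lemma card_rows: "card (rows n \<Lambda>) = (\<Prod>s\<in>{1..<n}. \<Lambda> s)"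
  unfolding rows_def by (simp add: card_PiE)

lemma finite_ooc_index: "finite (ooc_index n \<Lambda> T)"
  by (simp add: ooc_index_eq finite_rows)

definition cyclic_shift :: "nat \<Rightarrow> nat \<Rightarrow> 'a \<times> nat \<Rightarrow> 'a \<times> nat" where
  "cyclic_shift T t p = (fst p, (snd p + t) mod T)"

text \<open>The ones of the array \<open>A\<close> rotated by \<open>t\<close> columns to the left; a one of \<open>A\<close> in column
  \<open>t\<close> moves to column 0.\<close>

definition shifted_support ::
  "nat \<Rightarrow> (nat \<Rightarrow> nat) \<Rightarrow> nat \<Rightarrow> ((nat \<Rightarrow> nat) \<times> nat \<Rightarrow> nat) \<Rightarrow> nat \<Rightarrow> ((nat \<Rightarrow> nat) \<times> nat) set"
  where
  "shifted_support n \<Lambda> T A t = {p \<in> ooc_index n \<Lambda> T. A (cyclic_shift T t p) = 1}"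

lemma shifted_support_0: "shifted_support n \<Lambda> T A 0 = {p \<in> ooc_index n \<Lambda> T. A p = 1}"
  by (auto simp: shifted_support_def cyclic_shift_def ooc_index_eq)

lemma cyclic_shift_in_index:
  "T > 0 \<Longrightarrow> p \<in> ooc_index n \<Lambda> T \<Longrightarrow> cyclic_shift T t p \<in> ooc_index n \<Lambda> T"
  by (auto simp: ooc_index_eq cyclic_shift_def)

lemma inj_on_cyclic_shift: "inj_on (cyclic_shift T t) (ooc_index n \<Lambda> T)"
proof (rule inj_onI)
  fix p q
  assume pq: "p \<in> ooc_index n \<Lambda> T" "q \<in> ooc_index n \<Lambda> T"
    and eq: "cyclic_shift T t p = cyclic_shift T t q"
  from eq have "[snd p + t = snd q + t] (mod T)"
    by (simp add: cyclic_shift_def cong_def)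
  then have "[snd p = snd q] (mod T)"
    by (simp only: cong_add_rcancel_nat)
  with pq eq show "p = q"
    by (auto simp: ooc_index_eq cyclic_shift_def cong_def prod_eq_iff)
qed

lemma bij_betw_cyclic_shift:
  assumes "T > 0"
  shows "bij_betw (cyclic_shift T t) (ooc_index n \<Lambda> T) (ooc_index n \<Lambda> T)"
proof -
  have "cyclic_shift T t ` ooc_index n \<Lambda> T \<subseteq> ooc_index n \<Lambda> T"
    by (rule image_subsetI) (rule cyclic_shift_in_index[OF assms])
  then show ?thesis
    using endo_inj_surj[OF finite_ooc_index _ inj_on_cyclic_shift] inj_on_cyclic_shift
    by (simp add: bij_betw_def)
qed

lemma card_shifted_support:
  assumes "T > 0"
  shows "card (shifted_support n \<Lambda> T A t) = card {p \<in> ooc_index n \<Lambda> T. A p = 1}"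
proof (rule bij_betw_same_card)
  show "bij_betw (cyclic_shift T t) (shifted_support n \<Lambda> T A t) {p \<in> ooc_index n \<Lambda> T. A p = 1}"
  proof (rule bij_betw_subset[OF bij_betw_cyclic_shift[OF assms, of t n \<Lambda>]])
    have "cyclic_shift T t ` ooc_index n \<Lambda> T = ooc_index n \<Lambda> T"
      using bij_betw_cyclic_shift[OF assms] by (rule bij_betw_imp_surj_on)
    then show "cyclic_shift T t ` shifted_support n \<Lambda> T A t = {p \<in> ooc_index n \<Lambda> T. A p = 1}"
      using Compr_image_eq[of "cyclic_shift T t" "ooc_index n \<Lambda> T" "\<lambda>p. A p = 1"]
      by (simp only: shifted_support_def)
  qed (auto simp: shifted_support_def)
qed

text \<open>The residue \<open>(u + T - s) mod T\<close> is the difference \<open>u - s\<close>, kept nonnegative.\<close>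

lemma cyclic_shift_cyclic_shift_diff:
  assumes "s < T"
  shows "cyclic_shift T ((u + T - s) mod T) (cyclic_shift T s p) = cyclic_shift T u p"
proof -
  have "((snd p + s) mod T + (u + T - s) mod T) mod T = ((snd p + s) + (u + T - s)) mod T"
    by (simp add: mod_simps)
  also have "(snd p + s) + (u + T - s) = (snd p + u) + T"
    using assms by simp
  finally show ?thesis
    by (simp add: cyclic_shift_def)
qed

lemma correlation_eq:
  "correlation n \<Lambda> T A B t = (\<Sum>p\<in>ooc_index n \<Lambda> T. A p * B (cyclic_shift T t p))"
  unfolding correlation_def by (intro sum.cong) (auto simp: cyclic_shift_def)

lemma card_common_ones_le_correlation:
  "card {p \<in> ooc_index n \<Lambda> T. A p = 1 \<and> B (cyclic_shift T t p) = 1} \<le> correlation n \<Lambda> T A B t"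
proof -
  let ?S = "{p \<in> ooc_index n \<Lambda> T. A p = 1 \<and> B (cyclic_shift T t p) = 1}"
  have "card ?S = (\<Sum>p\<in>?S. A p * B (cyclic_shift T t p))"
    by simp
  also have "\<dots> \<le> (\<Sum>p\<in>ooc_index n \<Lambda> T. A p * B (cyclic_shift T t p))"
    by (intro sum_mono2 finite_ooc_index) auto
  finally show ?thesis
    by (simp add: correlation_eq)
qed

text \<open>Shifting both arrays by \<open>s\<close> preserves the number of common ones, so only the
  difference of the two shifts matters.\<close>

lemma card_inter_shifted_support_le:
  assumes "s < T"
  shows "card (shifted_support n \<Lambda> T A s \<inter> shifted_support n \<Lambda> T B u)
    \<le> correlation n \<Lambda> T A B ((u + T - s) mod T)"
proof -
  let ?t = "(u + T - s) mod T"
  have "card (shifted_support n \<Lambda> T A s \<inter> shifted_support n \<Lambda> T B u)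
      \<le> card {p \<in> ooc_index n \<Lambda> T. A p = 1 \<and> B (cyclic_shift T ?t p) = 1}"
  proof (rule card_inj_on_le)
    show "inj_on (cyclic_shift T s) (shifted_support n \<Lambda> T A s \<inter> shifted_support n \<Lambda> T B u)"
      by (rule inj_on_subset[OF inj_on_cyclic_shift]) (auto simp: shifted_support_def)
  qed (use assms in \<open>auto simp: shifted_support_def cyclic_shift_cyclic_shift_diff
        cyclic_shift_in_index finite_ooc_index\<close>)
  also note card_common_ones_le_correlation
  finally show ?thesis .
qed

text \<open>Two ones of \<open>A\<close> in the same row, in columns \<open>c \<noteq> c'\<close>, would contribute to the
  autocorrelation at the nonzero shift \<open>c' - c\<close>.\<close>

lemma inj_on_fst_support:
  assumes C: "is_ooc n \<Lambda> T w 0 lc C" and A: "A \<in> C"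
  shows "inj_on fst {p \<in> ooc_index n \<Lambda> T. A p = 1}"
proof (rule inj_onI, rule ccontr)
  fix p q
  assume pq: "p \<in> {p \<in> ooc_index n \<Lambda> T. A p = 1}" "q \<in> {p \<in> ooc_index n \<Lambda> T. A p = 1}"
    and fst: "fst p = fst q" and "p \<noteq> q"
  define t where "t = (snd q + T - snd p) mod T"
  have lt: "snd p < T" "snd q < T"
    using pq by (auto simp: ooc_index_eq)
  have "p = cyclic_shift T (snd p) (fst p, 0)" "q = cyclic_shift T (snd q) (fst p, 0)"
    using lt fst by (auto simp: cyclic_shift_def prod_eq_iff)
  then have q: "cyclic_shift T t p = q"
    unfolding t_def using cyclic_shift_cyclic_shift_diff[OF lt(1)] by metis
  have "t \<noteq> 0"
  proof
    assume "t = 0"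
    then have "cyclic_shift T t p = p"
      using lt by (simp add: cyclic_shift_def)
    with q \<open>p \<noteq> q\<close> show False
      by simp
  qed
  moreover have "t < T"
    using lt by (simp add: t_def)
  ultimately have "correlation n \<Lambda> T A A t = 0"
    using C A by (auto simp: is_ooc_def)
  then have "card {p \<in> ooc_index n \<Lambda> T. A p = 1 \<and> A (cyclic_shift T t p) = 1} = 0"
    using card_common_ones_le_correlation[of n \<Lambda> T A A t] by simp
  moreover have "p \<in> {p \<in> ooc_index n \<Lambda> T. A p = 1 \<and> A (cyclic_shift T t p) = 1}"
    using pq q by simp
  ultimately show False
    using finite_ooc_index[of n \<Lambda> T] by (auto simp del: split_paired_All)
qed

lemma inj_on_fst_shifted_support:
  assumes C: "is_ooc n \<Lambda> T w 0 lc C" and A: "A \<in> C" and "T > 0"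
  shows "inj_on fst (shifted_support n \<Lambda> T A t)"
proof -
  have "inj_on (fst \<circ> cyclic_shift T t) (shifted_support n \<Lambda> T A t)"
  proof (rule comp_inj_on)
    show "inj_on (cyclic_shift T t) (shifted_support n \<Lambda> T A t)"
      by (rule inj_on_subset[OF inj_on_cyclic_shift]) (auto simp: shifted_support_def)
    show "inj_on fst (cyclic_shift T t ` shifted_support n \<Lambda> T A t)"
      by (rule inj_on_subset[OF inj_on_fst_support[OF C A]])
        (auto simp: shifted_support_def cyclic_shift_in_index[OF \<open>T > 0\<close>])
  qed
  moreover have "fst \<circ> cyclic_shift T t = (fst :: (nat \<Rightarrow> nat) \<times> nat \<Rightarrow> nat \<Rightarrow> nat)"
    by (auto simp: cyclic_shift_def)
  ultimately show ?thesis
    by simp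
qed

lemma ideal_ooc_weight_le:
  assumes C: "is_ooc n \<Lambda> T w 0 lc C"
  shows "w \<le> card (rows n \<Lambda>)"
proof -
  obtain A where A: "A \<in> C"
    using C by (auto simp: is_ooc_def)
  then have "w = card {p \<in> ooc_index n \<Lambda> T. A p = 1}"
    using C by (auto simp: is_ooc_def)
  also have "\<dots> \<le> card (rows n \<Lambda>)"
    by (rule card_inj_on_le[OF inj_on_fst_support[OF C A] _ finite_rows])
      (auto simp: ooc_index_eq)
  finally show ?thesis .
qed

lemma ideal_ooc_maximal_weight_exists:
  assumes "T > 0"
  shows "\<exists>C. is_ooc n \<Lambda> T (card (rows n \<Lambda>)) 0 lc C"
proof -
  define A where
    "A = restrict (\<lambda>p. if snd p = 0 then 1 else 0 :: nat) (ooc_index n \<Lambda> T)"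
  have "{p \<in> ooc_index n \<Lambda> T. A p = 1} = rows n \<Lambda> \<times> {0}"
    using assms by (auto simp: A_def ooc_index_eq)
  then have "card {p \<in> ooc_index n \<Lambda> T. A p = 1} = card (rows n \<Lambda>)"
    by (simp add: card_cartesian_product)
  moreover have "correlation n \<Lambda> T A A t = 0" if "1 \<le> t" "t < T" for t
    unfolding correlation_eq using that
    by (intro sum.neutral) (auto simp: A_def cyclic_shift_def ooc_index_eq)
  moreover have "A \<in> binary_arrays n \<Lambda> T"
    by (auto simp: A_def binary_arrays_def)
  ultimately have "is_ooc n \<Lambda> T (card (rows n \<Lambda>)) 0 lc {A}"
    by (auto simp: is_ooc_def)
  then show ?thesis
    by blast
qed

section \<open>The bound for ideal codes\<close>

text \<open>The codewords that meet row \<open>r\<close> are shifted individually so that they meet it in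
  column 0. As \<open>\<lambda>\<^sub>c < w\<close>, distinct codewords remain distinct.\<close>

lemma card_meeting_row_le:
  assumes C: "is_ooc n \<Lambda> T w 0 lc C" and "T > 0" "lc < w" and r: "r \<in> rows n \<Lambda>"
  shows "int (card {A \<in> C. \<exists>c<T. A (r, c) = 1})
    \<le> iterated_floor lc (\<lambda>i. (real (card (rows n \<Lambda>)) - real (Suc i)) * real T
        / (real w - real (Suc i)))"
proof -
  define D where "D = {A \<in> C. \<exists>c<T. A (r, c) = 1}"
  define col where "col A = (SOME c. c < T \<and> A (r, c) = (1::nat))" for A
  define g where "g A = shifted_support n \<Lambda> T A (col A)" for A
  have col: "col A < T" "A (r, col A) = 1" if "A \<in> D" for A
    using someI_ex[of "\<lambda>c. c < T \<and> A (r, c) = 1"] that by (auto simp: D_def col_def)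
  have card_g: "card (g A) = w" if "A \<in> D" for A
    using that C \<open>T > 0\<close> by (auto simp: g_def D_def card_shifted_support is_ooc_def)
  have inter: "card (g A \<inter> g B) < Suc lc" if "A \<in> D" "B \<in> D" "A \<noteq> B" for A B
  proof -
    have "card (g A \<inter> g B) \<le> correlation n \<Lambda> T A B ((col B + T - col A) mod T)"
      unfolding g_def by (rule card_inter_shifted_support_le) (use col that in auto)
    also have "\<dots> \<le> lc"
      using C that \<open>T > 0\<close> by (auto simp: is_ooc_def D_def)
    finally show ?thesis
      by simp
  qed
  have "inj_on g D"
  proof (rule inj_onI, rule ccontr)
    fix A B
    assume AB: "A \<in> D" "B \<in> D" "g A = g B" "A \<noteq> B"
    then have "w < Suc lc"
      using inter[of A B] card_g[of B] by simp
    with \<open>lc < w\<close> show False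
      by simp
  qed
  have p: "(r, 0) \<in> X" if "X \<in> g ` D" for X
    using that r col \<open>T > 0\<close>
    by (auto simp: g_def shifted_support_def cyclic_shift_def ooc_index_eq)
  have "g A \<subseteq> rows n \<Lambda> \<times> {..<T}" for A
    by (auto simp: g_def shifted_support_def ooc_index_eq)
  moreover have "inj_on fst (g A)" if "A \<in> D" for A
    using that C \<open>T > 0\<close> by (auto simp: g_def D_def intro: inj_on_fst_shifted_support)
  ultimately have "packing (rows n \<Lambda>) {..<T} w (Suc lc) (g ` D)"
    unfolding packing_def using inter card_g by blast
  note del = packing_delete_common_point[OF this p finite_rows finite_lessThan, simplified fst_conv]
  have w: "w \<le> card (rows n \<Lambda>)"
    by (rule ideal_ooc_weight_le[OF C])
  have card_rows': "card (rows n \<Lambda> - {r}) = card (rows n \<Lambda>) - 1"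
    using r by simp
  have "int (card D) = int (card ((\<lambda>X. X - {(r, 0)}) ` g ` D))"
    using del(2) card_image[OF \<open>inj_on g D\<close>] by simp
  also have "\<dots> \<le> iterated_floor lc (\<lambda>i. (real (card (rows n \<Lambda> - {r})) - real i)
      * real (card {..<T}) / (real (w - 1) - real i))"
    using del(1) w \<open>lc < w\<close> by (intro card_packing_le) (auto simp: finite_rows card_rows')
  also have "\<dots> = iterated_floor lc (\<lambda>i. (real (card (rows n \<Lambda>)) - real (Suc i)) * real T
      / (real w - real (Suc i)))"
    unfolding card_rows' using w \<open>lc < w\<close>
    by (intro iterated_floor_cong) (simp add: algebra_simps)
  finally show ?thesis
    by (simp add: D_def)
qed

lemma card_ideal_ooc_le:
  assumes C: "is_ooc n \<Lambda> T w 0 lc C" and "T > 0" "lc < w"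
  shows "int (card C) \<le> nested_floor lc (johnson_factor (card (rows n \<Lambda>) * T) T w)"
proof -
  define d where "d = iterated_floor lc
    (\<lambda>i. (real (card (rows n \<Lambda>)) - real (Suc i)) * real T / (real w - real (Suc i)))"
  have "C \<subseteq> binary_arrays n \<Lambda> T"
    using C by (simp add: is_ooc_def)
  then have "finite C"
    using finite_binary_arrays by (rule finite_subset)
  have row_count: "card {r \<in> rows n \<Lambda>. \<exists>c<T. A (r, c) = 1} = w" if "A \<in> C" for A
  proof -
    have "{r \<in> rows n \<Lambda>. \<exists>c<T. A (r, c) = 1} = fst ` {p \<in> ooc_index n \<Lambda> T. A p = 1}"
      by (force simp: ooc_index_eq)
    then show ?thesis
      using card_image[OF inj_on_fst_support[OF C that]] C that by (simp add: is_ooc_def)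
  qed
  have "int (card C) \<le> \<lfloor>real (card (rows n \<Lambda>)) / real w * of_int d\<rfloor>"
    using \<open>finite C\<close> finite_rows row_count card_meeting_row_le[OF C \<open>T > 0\<close> \<open>lc < w\<close>] \<open>lc < w\<close>
    unfolding d_def
    by (intro card_le_of_incidence_bound[where I = "\<lambda>A r. \<exists>c<T. A (r, c) = 1"]) auto
  also have "d = iterated_floor lc (\<lambda>i. johnson_factor (card (rows n \<Lambda>) * T) T w (Suc i))"
    unfolding d_def by (intro iterated_floor_cong) (simp add: johnson_factor_def algebra_simps)
  also have "real (card (rows n \<Lambda>)) / real w = johnson_factor (card (rows n \<Lambda>) * T) T w 0"
    using \<open>T > 0\<close> by (simp add: johnson_factor_def)
  finally show ?thesis
    by (simp add: nested_floor_eq_iterated_floor)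
qed

text \<open>At the maximal weight \<open>w = N / T\<close> the outermost factor is 1 and the others are \<open>T\<close>.\<close>

lemma nested_floor_johnson_factor_maximal_weight:
  assumes "T > 0" "lc < w"
  shows "nested_floor lc (johnson_factor (w * T) T w) = int (T ^ lc)"
proof -
  have "johnson_factor (w * T) T w (Suc i) = real T" if "i < lc" for i
  proof -
    have "real (w * T) - real (Suc i) * real T = (real w - real (Suc i)) * real T"
      by (simp add: algebra_simps)
    moreover have "real w - real (Suc i) \<noteq> 0"
      using that assms by simp
    ultimately show ?thesis
      by (simp only: johnson_factor_def) simp
  qed
  then have "iterated_floor lc (\<lambda>i. johnson_factor (w * T) T w (Suc i)) = int (T ^ lc)"
    by (simp cong: iterated_floor_cong add: iterated_floor_const del: of_nat_power)
  moreover have "johnson_factor (w * T) T w 0 = 1"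
    using assms by (simp add: johnson_factor_def)
  ultimately show ?thesis
    by (simp add: nested_floor_eq_iterated_floor del: of_nat_power)
qed

theorem theorem1p6:
  fixes n T w lc N \<Phi> :: nat and \<Lambda> :: "nat \<Rightarrow> nat"
  assumes "n \<ge> 1"
    and "\<And>s. 1 \<le> s \<Longrightarrow> s < n \<Longrightarrow> \<Lambda> s > 0"
    and "T > 0"
    and "w > 0"
    and "lc < w"
    and "N = (\<Prod>s\<in>{1..<n}. \<Lambda> s) * T"
    and "\<exists>C. is_ooc n \<Lambda> T w 0 lc C"
    and "\<Phi> = max_ooc_size n \<Lambda> T w 0 lc"
  shows "int \<Phi> \<le> nested_floor lc (johnson_factor N T w)
    \<and> (real w = real N / real T \<longrightarrow> \<Phi> \<le> T ^ lc)
    \<and> (\<exists>w' C. real w' = real N / real T \<and> is_ooc n \<Lambda> T w' 0 lc C)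
    \<and> (\<forall>w' C. is_ooc n \<Lambda> T w' 0 lc C \<longrightarrow> real w' \<le> real N / real T)"
proof -
  have N: "N = card (rows n \<Lambda>) * T"
    using assms(6) by (simp only: card_rows)
  then have M: "real N / real T = real (card (rows n \<Lambda>))"
    using \<open>T > 0\<close> by simp
  have "\<Phi> \<in> {card C |C. is_ooc n \<Lambda> T w 0 lc C}"
    unfolding assms(8) max_ooc_size_def using assms(7)
    by (intro Max_in finite_ooc_sizes) auto
  then obtain C where "is_ooc n \<Lambda> T w 0 lc C" "\<Phi> = card C"
    by blast
  then have bound: "int \<Phi> \<le> nested_floor lc (johnson_factor N T w)"
    using card_ideal_ooc_le \<open>T > 0\<close> \<open>lc < w\<close> N by simp
  moreover have "\<Phi> \<le> T ^ lc" if "real w = real N / real T"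
  proof -
    have "N = w * T"
      using that N M by simp
    then have "int \<Phi> \<le> int (T ^ lc)"
      using bound nested_floor_johnson_factor_maximal_weight[OF \<open>T > 0\<close> \<open>lc < w\<close>] by simp
    then show ?thesis
      by (simp only: of_nat_le_iff)
  qed
  moreover have "\<exists>w' C. real w' = real N / real T \<and> is_ooc n \<Lambda> T w' 0 lc C"
    using ideal_ooc_maximal_weight_exists[OF \<open>T > 0\<close>] M by metis
  moreover have "real w' \<le> real N / real T" if "is_ooc n \<Lambda> T w' 0 lc C" for w' C
    using ideal_ooc_weight_le[OF that] M by simp
  ultimately show ?thesis
    by blast
qed

end
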